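(* Every first countable cellular-compact $T_2$ space $X$ is $T_3$, and consequently satisfies $|X|\le \mathfrak{c}=2^{\omega}$.
   Context: $T_2$ means Hausdorff; $T_3$ means regular and $T_1$. A cellular family in a topological space is a family of pairwise disjoint non-empty open sets. A space $X$ is cellular-compact if for every cellular family $\mathcal{U}$ of open subsets of $X$ there is a compact subspace $K\subset X$ such that $K\cap U\neq\emptyset$ for each $U\in\mathcal{U}$. *)

theory Defs
  imports "HOL-Analysis.Analysis" "HOL-Library.Equipollence"
begin

definition cellular_family :: "'a topology \<Rightarrow> 'a set set \<Rightarrow> bool" where
  "cellular_family X \<U> \<longleftrightarrow> (\<forall>U\<in>\<U>. openin X U \<and> U \<noteq> {}) \<and> pairwise disjnt \<U>"

definition cellular_compact :: "'a topology \<Rightarrow> bool" where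
  "cellular_compact X \<longleftrightarrow>
    (\<forall>\<U>. cellular_family X \<U> \<longrightarrow> (\<exists>K. compactin X K \<and> (\<forall>U\<in>\<U>. K \<inter> U \<noteq> {})))"

(* regular_space on its own does not include T_1 *)
definition T3_space :: "'a topology \<Rightarrow> bool" where
  "T3_space X \<longleftrightarrow> regular_space X \<and> t1_space X"

end

theory Submission
  imports Defs
begin

text \<open>Everything rests on one observation (\<open>cellular_compact_disjoint_limits\<close>): if \<open>G i\<close> are disjoint open
sets and \<open>x i\<close> is in the closure of \<open>G i\<close>, then some compact set contains all the \<open>x i\<close>. Indeed, by
first countability each \<open>G i\<close> contains a cellular family with members in every neighbourhood of
\<open>x i\<close>, and a compact set that meets all members of all these families is closed and hence contains
every \<open>x i\<close>.

A failure of regularity at a point gives a sequence of points outside some neighbourhood of it that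
lie in the differences of the closures of successive members of a decreasing neighbourhood base. They
are all in one compact set by the observation, and this set then has a cover without finite subcover
(\<open>cellular_compact_imp_regular_space\<close>).

For the cardinality bound, the same observation says that a set of points with a disjoint open
expansion has compact closure. An \<open>\<omega>\<^sub>1\<close>-sequence that is a free sequence in a strong sense would be
such a set; its compact closure would be the union of a strictly increasing \<open>\<omega>\<^sub>1\<close>-chain of relatively
open sets, which is absurd. Therefore every cover of a closed set \<open>F\<close> by open neighbourhoods of its
points has a countable subfamily whose union has \<open>F\<close> in its closure
(\<open>closedin_cover_countable_dense\<close>). Together with regularity and first countability this is enough
for the closing-off argument of Arhangelskii's theorem, with closures of unions in place of unions
(\<open>regular_first_countable_lepoll_continuum\<close>).\<close>

section \<open>Decreasing neighbourhood bases\<close>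

definition decreasing_base :: "'a topology \<Rightarrow> 'a \<Rightarrow> (nat \<Rightarrow> 'a set) \<Rightarrow> bool" where
  "decreasing_base X x B \<longleftrightarrow>
    (\<forall>n. openin X (B n) \<and> x \<in> B n) \<and> decseq B \<and>
    (\<forall>U. openin X U \<and> x \<in> U \<longrightarrow> (\<exists>n. B n \<subseteq> U))"

lemma decreasing_baseD:
  assumes "decreasing_base X x B"
  shows "openin X (B n)" "x \<in> B n" "m \<le> n \<Longrightarrow> B n \<subseteq> B m"
    "openin X U \<Longrightarrow> x \<in> U \<Longrightarrow> \<exists>n. B n \<subseteq> U"
  using assms by (auto simp: decreasing_base_def decseq_def)

lemma first_countable_decreasing_base:
  assumes "first_countable X" "x \<in> topspace X"
  obtains B where "decreasing_base X x B"
proof -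
  obtain \<B> where \<B>: "countable \<B>" "\<And>V. V \<in> \<B> \<Longrightarrow> openin X V"
    and small: "\<And>U. openin X U \<Longrightarrow> x \<in> U \<Longrightarrow> \<exists>V\<in>\<B>. x \<in> V \<and> V \<subseteq> U"
    using assms unfolding first_countable_def by metis
  define \<C> where "\<C> = {V \<in> \<B>. x \<in> V}"
  have "countable \<C>" "\<C> \<noteq> {}"
    using \<B>(1) small[of "topspace X"] assms(2) by (auto simp: \<C>_def)
  then have ran: "range (from_nat_into \<C>) = \<C>"
    by (simp add: range_from_nat_into)
  define B where "B n = (\<Inter>i\<le>n. from_nat_into \<C> i)" for n
  have mem: "from_nat_into \<C> i \<in> \<C>" for i
    using ran by auto
  have "openin X (B n)" for n
    unfolding B_def using mem \<B>(2) by (intro openin_Inter) (auto simp: \<C>_def)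
  moreover have "x \<in> B n" for n
    unfolding B_def using mem by (auto simp: \<C>_def)
  moreover have "decseq B"
    unfolding decseq_def B_def by fastforce
  moreover have "\<exists>n. B n \<subseteq> U" if U: "openin X U" "x \<in> U" for U
  proof -
    obtain V where "V \<in> \<C>" "V \<subseteq> U"
      using small[OF U] by (auto simp: \<C>_def)
    then obtain n where "from_nat_into \<C> n \<subseteq> U"
      using ran by (metis imageE)
    then show ?thesis
      unfolding B_def by blast
  qed
  ultimately have "decreasing_base X x B"
    by (simp add: decreasing_base_def)
  then show ?thesis
    by (rule that)
qed

lemma strict_mono_choice:
  assumes "\<And>n::nat. \<exists>m>n. R n m"
  shows "\<exists>s. strict_mono s \<and> (\<forall>k. R (s k) (s (Suc k)))"
proof -
  have "\<exists>s. \<forall>k::nat. True \<and> s k < s (Suc k) \<and> R (s k) (s (Suc k))"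
    using assms by (intro dependent_nat_choice) auto
  then show ?thesis
    by (auto simp: strict_mono_Suc_iff)
qed

lemma Hausdorff_decreasing_base_separates:
  assumes "Hausdorff_space X" "decreasing_base X x B" "y \<in> topspace X" "y \<noteq> x"
  shows "\<exists>m>n. \<exists>Q. openin X Q \<and> y \<in> Q \<and> disjnt Q (B m)"
proof -
  have "x \<in> topspace X"
    using decreasing_baseD(1,2)[OF assms(2)] openin_subset by blast
  then obtain Q V where Q: "openin X Q" "openin X V" "y \<in> Q" "x \<in> V" "disjnt Q V"
    using assms unfolding Hausdorff_space_def by metis
  then obtain k where "B k \<subseteq> V"
    using decreasing_baseD(4)[OF assms(2)] by blast
  then have "B (max k (Suc n)) \<subseteq> V"
    using decreasing_baseD(3)[OF assms(2), of k "max k (Suc n)"] by auto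
  then have "disjnt Q (B (max k (Suc n)))"
    using Q(5) unfolding disjnt_def by blast
  then show ?thesis
    using Q by (intro exI[of _ "max k (Suc n)"] conjI exI[of _ Q]) auto
qed

section \<open>Cellular families converging to points\<close>

text \<open>A single set in the family could be met far away from \<open>x\<close>. The point of the family is that a
set meeting all its members has \<open>x\<close> in its closure. Unless \<open>x\<close> is isolated, each basic
neighbourhood of \<open>x\<close> contains a point \<open>y \<noteq> x\<close> of \<open>G\<close>, and Hausdorffness gives an open piece of
\<open>G\<close> around \<open>y\<close> that avoids some later basic neighbourhood, inside which the next piece is chosen.\<close>

lemma cellular_family_hugging_point:
  assumes fc: "first_countable X" and T2: "Hausdorff_space X"
    and G: "openin X G" and x: "x \<in> X closure_of G"
  shows "\<exists>\<W>. cellular_family X \<W> \<and> (\<forall>W\<in>\<W>. W \<subseteq> G) \<and>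
      (\<forall>U. openin X U \<and> x \<in> U \<longrightarrow> (\<exists>W\<in>\<W>. W \<subseteq> U))"
proof (cases "openin X {x}")
  case True
  then have "x \<in> G"
    using x by (auto simp: in_closure_of)
  then show ?thesis
    using True by (intro exI[of _ "{{x}}"]) (auto simp: cellular_family_def)
next
  case False
  have "x \<in> topspace X"
    using x by (simp add: in_closure_of)
  then obtain B where B: "decreasing_base X x B"
    using first_countable_decreasing_base[OF fc] by blast
  have "\<exists>m>n. \<exists>W. openin X W \<and> W \<noteq> {} \<and> W \<subseteq> B n \<inter> G \<and> disjnt W (B m)" for n
  proof -
    have op: "openin X (B n \<inter> G)"
      using decreasing_baseD(1)[OF B] G by (simp add: openin_Int)
    have "B n \<inter> G \<noteq> {}"
      using x decreasing_baseD(1,2)[OF B, of n] unfolding in_closure_of by blast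
    moreover have "B n \<inter> G \<noteq> {x}"
      using op False by metis
    ultimately obtain y where y: "y \<in> B n \<inter> G" "y \<noteq> x"
      by blast
    have "y \<in> topspace X"
      using y op openin_subset by blast
    then obtain m Q where "n < m" "openin X Q" "y \<in> Q" "disjnt Q (B m)"
      using Hausdorff_decreasing_base_separates[OF T2 B _ y(2), of n] by blast
    then show ?thesis
      using y op by (intro exI[of _ m] conjI exI[of _ "Q \<inter> (B n \<inter> G)"])
        (auto simp: openin_Int disjnt_def)
  qed
  then have "\<exists>s. strict_mono s \<and> (\<forall>k. \<exists>W. openin X W \<and> W \<noteq> {} \<and>
      W \<subseteq> B (s k) \<inter> G \<and> disjnt W (B (s (Suc k))))"
    by (rule strict_mono_choice)
  then obtain s where s: "strict_mono s" and "\<forall>k. \<exists>W. openin X W \<and> W \<noteq> {} \<and>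
      W \<subseteq> B (s k) \<inter> G \<and> disjnt W (B (s (Suc k)))"
    by blast
  then have "\<exists>W. \<forall>k. openin X (W k) \<and> W k \<noteq> {} \<and> W k \<subseteq> B (s k) \<inter> G \<and>
      disjnt (W k) (B (s (Suc k)))"
    by (intro choice)
  then obtain W where "\<forall>k. openin X (W k) \<and> W k \<noteq> {} \<and> W k \<subseteq> B (s k) \<inter> G \<and>
      disjnt (W k) (B (s (Suc k)))" ..
  then have W: "openin X (W k)" "W k \<noteq> {}" "W k \<subseteq> B (s k) \<inter> G"
    "disjnt (W k) (B (s (Suc k)))" for k
    by simp_all
  have less: "disjnt (W i) (W j)" if "i < j" for i j
  proof -
    have "B (s j) \<subseteq> B (s (Suc i))"
      using that s by (intro decreasing_baseD(3)[OF B]) (simp add: strict_mono_less_eq)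
    then show ?thesis
      using W(3)[of j] W(4)[of i] unfolding disjnt_def by blast
  qed
  have "pairwise disjnt (range W)"
  proof (rule pairwiseI)
    fix V V' assume "V \<in> range W" "V' \<in> range W" "V \<noteq> V'"
    then obtain i j where ij: "V = W i" "V' = W j" "i \<noteq> j"
      by auto
    then show "disjnt V V'"
      using less[of i j] less[of j i] by (metis disjnt_sym nat_neq_iff)
  qed
  then have "cellular_family X (range W)"
    using W(1,2) by (simp add: cellular_family_def)
  moreover have "\<exists>V\<in>range W. V \<subseteq> U" if U: "openin X U" "x \<in> U" for U
  proof -
    obtain n where "B n \<subseteq> U"
      using decreasing_baseD(4)[OF B U] by blast
    moreover have "B (s n) \<subseteq> B n"
      using s by (intro decreasing_baseD(3)[OF B]) (rule strict_mono_imp_increasing)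
    ultimately show ?thesis
      using W(3)[of n] by blast
  qed
  ultimately show ?thesis
    using W(3) by (intro exI[of _ "range W"]) auto
qed

text \<open>The form in which cellular-compactness is applied throughout. The union of the families
converging to the \<open>x i\<close> inside the disjoint sets \<open>G i\<close> is again cellular, and a compact set
meeting all its members, being closed, contains every \<open>x i\<close>. It matters that \<open>x i\<close> need only be in
the closure of \<open>G i\<close>: the proof of regularity uses points on the boundaries of the \<open>G i\<close>.\<close>

lemma cellular_compact_disjoint_limits:
  assumes fc: "first_countable X" and cc: "cellular_compact X" and T2: "Hausdorff_space X"
    and G: "\<And>i. i \<in> I \<Longrightarrow> openin X (G i)" and disj: "disjoint_family_on G I"
    and x: "\<And>i. i \<in> I \<Longrightarrow> x i \<in> X closure_of G i"
  obtains K where "compactin X K" "x ` I \<subseteq> K"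
proof -
  have "\<forall>i\<in>I. \<exists>\<W>. cellular_family X \<W> \<and> (\<forall>W\<in>\<W>. W \<subseteq> G i) \<and>
      (\<forall>U. openin X U \<and> x i \<in> U \<longrightarrow> (\<exists>W\<in>\<W>. W \<subseteq> U))"
    using cellular_family_hugging_point[OF fc T2 G x] by blast
  then obtain \<W> where \<W>: "\<And>i. i \<in> I \<Longrightarrow> cellular_family X (\<W> i)"
    "\<And>i W. i \<in> I \<Longrightarrow> W \<in> \<W> i \<Longrightarrow> W \<subseteq> G i"
    "\<And>i U. i \<in> I \<Longrightarrow> openin X U \<Longrightarrow> x i \<in> U \<Longrightarrow> \<exists>W\<in>\<W> i. W \<subseteq> U"
    by metis
  have "disjnt V W" if "i \<in> I" "j \<in> I" "V \<in> \<W> i" "W \<in> \<W> j" "V \<noteq> W" for i j V W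
  proof (cases "i = j")
    case True
    then show ?thesis
      using \<W>(1)[of i] that by (auto simp: cellular_family_def pairwise_def)
  next
    case False
    then show ?thesis
      using \<W>(2)[of i V] \<W>(2)[of j W] that disj
      unfolding disjoint_family_on_def disjnt_def by blast
  qed
  then have "cellular_family X (\<Union>i\<in>I. \<W> i)"
    using \<W>(1) by (fastforce simp: cellular_family_def pairwise_def)
  then obtain K where K: "compactin X K" and meets: "\<And>W. W \<in> (\<Union>i\<in>I. \<W> i) \<Longrightarrow> K \<inter> W \<noteq> {}"
    using cc unfolding cellular_compact_def by metis
  have "x i \<in> K" if i: "i \<in> I" for i
  proof -
    have "\<exists>y. y \<in> K \<and> y \<in> U" if U: "x i \<in> U" "openin X U" for U
      using \<W>(3)[OF i U(2,1)] meets i by blast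
    then have "x i \<in> X closure_of K"
      using x[OF i] by (auto simp: in_closure_of)
    then show ?thesis
      using compactin_imp_closedin[OF T2 K] by (simp add: closure_of_closedin)
  qed
  then show ?thesis
    using that[OF K] by blast
qed

section \<open>Regularity\<close>

text \<open>If the closures of all basic neighbourhoods \<open>B n\<close> of \<open>p\<close> stick out of \<open>U\<close>, then there are points
\<open>x k\<close> outside \<open>U\<close> in the successive differences of these closures, and the corresponding
differences \<open>G k\<close> are disjoint open sets with \<open>x k\<close> in their closures. So one compact set \<open>K\<close>
contains all \<open>x k\<close>. The closures of the \<open>B n\<close> have only \<open>p\<close> in common, so \<open>U\<close> together with their
complements covers \<open>K\<close>; a finite subcover misses \<open>x k\<close> for large \<open>k\<close>.\<close>

lemma cellular_compact_imp_regular_space: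
  assumes fc: "first_countable X" and cc: "cellular_compact X" and T2: "Hausdorff_space X"
  shows "regular_space X"
proof -
  have main: "\<exists>V. openin X V \<and> p \<in> V \<and> X closure_of V \<subseteq> U" if U: "openin X U" and p: "p \<in> U" for U p
  proof (rule ccontr)
    assume contra: "\<not> ?thesis"
    have "p \<in> topspace X"
      using U p openin_subset by blast
    then obtain B where B: "decreasing_base X p B"
      using first_countable_decreasing_base[OF fc] by blast
    have sep: "\<exists>m>n. y \<notin> X closure_of (B m)" if y: "y \<in> topspace X" "y \<noteq> p" for y n
    proof -
      obtain m Q where "n < m" "openin X Q" "y \<in> Q" "disjnt Q (B m)"
        using Hausdorff_decreasing_base_separates[OF T2 B y, of n] by blast
      then show ?thesis
        unfolding in_closure_of disjnt_def by blast
    qed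
    have "\<exists>m>n. \<exists>y. y \<in> X closure_of (B n) \<and> y \<notin> U \<and> y \<notin> X closure_of (B m)" for n
    proof -
      have "\<not> X closure_of (B n) \<subseteq> U"
        using contra decreasing_baseD(1,2)[OF B] by blast
      then obtain y where y: "y \<in> X closure_of (B n)" "y \<notin> U"
        by blast
      then have "y \<in> topspace X" "y \<noteq> p"
        using p by (auto simp: in_closure_of)
      then show ?thesis
        using sep y by blast
    qed
    then have "\<exists>s. strict_mono s \<and> (\<forall>k. \<exists>y. y \<in> X closure_of (B (s k)) \<and> y \<notin> U \<and>
        y \<notin> X closure_of (B (s (Suc k))))"
      by (rule strict_mono_choice)
    then obtain s where s: "strict_mono s" and "\<forall>k. \<exists>y. y \<in> X closure_of (B (s k)) \<and> y \<notin> U \<and>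
        y \<notin> X closure_of (B (s (Suc k)))"
      by blast
    then have "\<exists>x. \<forall>k. x k \<in> X closure_of (B (s k)) \<and> x k \<notin> U \<and>
        x k \<notin> X closure_of (B (s (Suc k)))"
      by (intro choice)
    then obtain x where x: "\<And>k. x k \<in> X closure_of (B (s k))" "\<And>k. x k \<notin> U"
      "\<And>k. x k \<notin> X closure_of (B (s (Suc k)))"
      by blast
    define G where "G k = B (s k) - X closure_of (B (s (Suc k)))" for k
    have G: "openin X (G k)" for k
      unfolding G_def by (intro openin_diff decreasing_baseD(1)[OF B]) auto
    have xG: "x k \<in> X closure_of (G k)" for k
    proof -
      have "\<exists>y. y \<in> G k \<and> y \<in> T" if T: "x k \<in> T" "openin X T" for T
      proof -
        have "openin X (T - X closure_of (B (s (Suc k))))"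
          using T by (intro openin_diff) auto
        moreover have "x k \<in> T - X closure_of (B (s (Suc k)))"
          using T x(3) by blast
        ultimately show ?thesis
          using x(1)[of k] unfolding in_closure_of G_def by (metis DiffD1 DiffD2 DiffI)
      qed
      then show ?thesis
        using x(1)[of k] by (auto simp: in_closure_of)
    qed
    have less: "G i \<inter> G j = {}" if "i < j" for i j
    proof -
      have "B (s j) \<subseteq> B (s (Suc i))"
        using that s by (intro decreasing_baseD(3)[OF B]) (simp add: strict_mono_less_eq)
      also have "\<dots> \<subseteq> X closure_of (B (s (Suc i)))"
        by (intro closure_of_subset openin_subset decreasing_baseD(1)[OF B])
      finally show ?thesis
        by (auto simp: G_def)
    qed
    then have "disjoint_family_on G UNIV"
      unfolding disjoint_family_on_def by (metis inf_commute nat_neq_iff)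
    then obtain K where K: "compactin X K" "range x \<subseteq> K"
      using cellular_compact_disjoint_limits[OF fc cc T2, of UNIV G x] G xG by blast
    define \<O> where "\<O> = insert U (range (\<lambda>n. topspace X - X closure_of (B n)))"
    have "K \<subseteq> \<Union>\<O>"
    proof
      fix y assume "y \<in> K"
      then have "y \<in> topspace X"
        using K(1) compactin_subset_topspace by blast
      then show "y \<in> \<Union>\<O>"
        using sep[of y] p by (cases "y = p") (auto simp: \<O>_def)
    qed
    moreover have "openin X Q" if "Q \<in> \<O>" for Q
      using that U by (auto simp: \<O>_def)
    ultimately obtain \<F> where \<F>: "finite \<F>" "\<F> \<subseteq> \<O>" "K \<subseteq> \<Union>\<F>"
      using compactinD[OF K(1)] by metis
    then have "finite (\<F> - {U})" "\<F> - {U} \<subseteq> range (\<lambda>n. topspace X - X closure_of (B n))"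
      by (auto simp: \<O>_def)
    then obtain N where N: "finite N" "\<F> - {U} = (\<lambda>n. topspace X - X closure_of (B n)) ` N"
      by (meson finite_subset_image)
    define k where "k = Max (insert 0 N)"
    have "n \<le> k" if "n \<in> N" for n
      using that N(1) by (simp add: k_def)
    then have "n \<le> s k" if "n \<in> N" for n
      using that strict_mono_imp_increasing[OF s, of k] by (meson le_trans)
    then have "x k \<in> X closure_of (B n)" if "n \<in> N" for n
      using that x(1)[of k] closure_of_mono[OF decreasing_baseD(3)[OF B]] by blast
    then have "x k \<notin> \<Union>(\<F> - {U})"
      using N(2) by auto
    then show False
      using x(2)[of k] K(2) \<F>(3) by blast
  qed
  show ?thesis
    unfolding regular_space_def
  proof (intro allI impI)
    fix C a assume Ca: "closedin X C \<and> a \<in> topspace X - C"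
    then obtain V where V: "openin X V" "a \<in> V" "X closure_of V \<subseteq> topspace X - C"
      using main[of "topspace X - C" a] by (metis closedin_def)
    have "C \<subseteq> topspace X"
      using Ca closedin_subset by blast
    then have "C \<subseteq> topspace X - X closure_of V"
      using V(3) by blast
    moreover have "disjnt V (topspace X - X closure_of V)"
      using closure_of_subset[OF openin_subset[OF V(1)]] by (auto simp: disjnt_def)
    moreover have "openin X (topspace X - X closure_of V)"
      by (intro openin_diff) auto
    ultimately show "\<exists>U V. openin X U \<and> openin X V \<and> a \<in> U \<and> C \<subseteq> V \<and> disjnt U V"
      using V(1,2) by blast
  qed
qed

section \<open>Countable subfamilies of covers of closed sets\<close>

lemma closure_of_disjointly_separated_compact:
  assumes fc: "first_countable X" and cc: "cellular_compact X" and T2: "Hausdorff_space X"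
    and W: "\<And>i. i \<in> I \<Longrightarrow> openin X (W i)" "\<And>i. i \<in> I \<Longrightarrow> x i \<in> W i"
    and disj: "disjoint_family_on W I"
  shows "compactin X (X closure_of (x ` I))"
proof -
  have "x i \<in> X closure_of W i" if "i \<in> I" for i
    using W[OF that] closure_of_subset[OF openin_subset] by blast
  then obtain K where K: "compactin X K" "x ` I \<subseteq> K"
    using cellular_compact_disjoint_limits[OF fc cc T2 W(1) disj, of x] by blast
  have "X closure_of (x ` I) \<subseteq> K"
    using compactin_imp_closedin[OF T2 K(1)] K(2) by (simp add: closure_of_minimal)
  then show ?thesis
    by (intro closed_compactin[OF K(1)]) auto
qed

text \<open>A strict well-order of type \<open>\<omega>\<^sub>1\<close>. The last property says that its cofinality is uncountable; with
\<open>J = {}\<close> it also says that \<open>I\<close> is nonempty.\<close>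

lemma omega1_like_order:
  obtains I :: "nat set set" and R where
    "wf R" "trans R" "total_on I R" "R \<subseteq> I \<times> I" "\<And>a. countable {b. (b, a) \<in> R}"
    "\<And>J. countable J \<Longrightarrow> J \<subseteq> I \<Longrightarrow> \<exists>a\<in>I. \<forall>j\<in>J. (j, a) \<in> R"
proof -
  include cardinal_syntax
  define r where "r = cardSuc |UNIV :: nat set|"
  have co: "Card_order r"
    unfolding r_def by (intro cardSuc_Card_order card_of_Card_order)
  then have wo: "Well_order r"
    by (rule card_order_on_well_order_on)
  have le: "countable A \<longleftrightarrow> |A| <o r" for A :: "nat set set"
  proof -
    have "countable A \<longleftrightarrow> |A| \<le>o |UNIV :: nat set|"
      unfolding countable_def card_of_ordLeq[symmetric] by simp
    also have "\<dots> \<longleftrightarrow> |A| <o cardSuc |UNIV :: nat set|"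
      by (rule cardSuc_ordLeq_ordLess[symmetric]) (rule card_of_Card_order)+
    finally show ?thesis
      unfolding r_def .
  qed
  have unc: "\<not> countable (Field r)"
    using le card_of_Field_ordIso[OF co] not_ordLess_ordIso by blast
  have seg: "countable (underS r a)" for a
  proof (cases "a \<in> Field r")
    case True
    then show ?thesis
      using card_of_underS[OF co] le by blast
  next
    case False
    then show ?thesis
      by (simp add: underS_empty)
  qed
  have lin: "trans r" "antisym r" "Total r"
    using wo by (simp_all add: order_on_defs)
  have eq: "{b. (b, a) \<in> r - Id} = underS r a" for a
    by (auto simp: underS_def)
  show ?thesis
  proof (rule that[of "r - Id" "Field r"])
    show "wf (r - Id)"
      using wo by (simp add: well_order_on_def)
    show "trans (r - Id)"
      using lin(1,2) by (simp add: trans_diff_Id)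
    show "total_on (Field r) (r - Id)"
      using lin(3) by (simp add: total_on_diff_Id)
    show "r - Id \<subseteq> Field r \<times> Field r"
      by (auto simp: Field_def)
    show "countable {b. (b, a) \<in> r - Id}" for a
      unfolding eq by (rule seg)
    show "\<exists>a\<in>Field r. \<forall>j\<in>J. (j, a) \<in> r - Id" if J: "countable J" "J \<subseteq> Field r" for J
    proof -
      have "countable (\<Union>j\<in>J. insert j (underS r j))"
        using J(1) seg by (intro countable_UN) auto
      then have "\<not> Field r \<subseteq> (\<Union>j\<in>J. insert j (underS r j))"
        using unc countable_subset by blast
      then obtain a where a: "a \<in> Field r" "a \<notin> (\<Union>j\<in>J. insert j (underS r j))"
        by blast
      have "(j, a) \<in> r - Id" if "j \<in> J" for j
      proof -
        have "j \<noteq> a" "(a, j) \<notin> r"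
          using a(2) that by (auto simp: underS_def)
        then show ?thesis
          using lin(3) a(1) J(2) that unfolding total_on_def by blast
      qed
      then show ?thesis
        using a(1) by blast
    qed
  qed
qed

lemma first_countable_closure_of_sequence:
  assumes "first_countable X" "y \<in> X closure_of S"
  obtains f :: "nat \<Rightarrow> 'a" where "range f \<subseteq> S" "limitin X f y sequentially"
proof -
  have y: "y \<in> topspace X"
    using assms(2) by (simp add: in_closure_of)
  then obtain B where B: "decreasing_base X y B"
    using first_countable_decreasing_base[OF assms(1)] by blast
  have "\<exists>z. z \<in> S \<and> z \<in> B n" for n
    using assms(2) decreasing_baseD(1,2)[OF B, of n] unfolding in_closure_of by blast
  then obtain f where f: "\<And>n. f n \<in> S" "\<And>n. f n \<in> B n"
    by metis
  have "eventually (\<lambda>n. f n \<in> U) sequentially" if U: "openin X U" "y \<in> U" for U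
  proof -
    obtain N where "B N \<subseteq> U"
      using decreasing_baseD(4)[OF B U] by blast
    then have "f n \<in> U" if "N \<le> n" for n
      using f(2)[of n] decreasing_baseD(3)[OF B that] by blast
    then show ?thesis
      by (auto simp: eventually_sequentially)
  qed
  then have "limitin X f y sequentially"
    using y by (simp add: limitin_def)
  then show ?thesis
    using that f(1) by blast
qed

lemma limitin_sequentially_imp_closure_of:
  assumes "limitin X f y sequentially" "range f \<subseteq> S"
  shows "y \<in> X closure_of S"
proof -
  have "\<exists>z. z \<in> S \<and> z \<in> T" if "y \<in> T" "openin X T" for T
  proof -
    have "eventually (\<lambda>n. f n \<in> T) sequentially"
      using assms(1) that by (simp add: limitin_def)
    then obtain n where "f n \<in> T"
      by (auto simp: eventually_sequentially)
    then show ?thesis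
      using assms(2) by auto
  qed
  then show ?thesis
    using assms(1) by (simp add: in_closure_of limitin_def)
qed

text \<open>Suppose that no countable subfamily works. Then an \<open>\<omega>\<^sub>1\<close>-sequence of points \<open>x a\<close> of \<open>F\<close> is chosen so
that \<open>x a\<close> avoids the closure of \<open>H a\<close>, the union of the sets \<open>U z\<close> over a countable set of centres
\<open>z\<close> that contains all earlier points and, moreover, enough centres to cover the closure of each
earlier initial segment and of the one before \<open>a\<close>. The sets \<open>U (x a)\<close> minus the closure of \<open>H a\<close>
are disjoint, hence any subset of the sequence has compact closure. In particular initial segments
have compact closures, which is why finitely many further centres cover them. By first countability
and the uncountable cofinality of \<open>\<omega>\<^sub>1\<close>, the closure of the whole sequence is the union of the
closures of its initial segments, so it is covered by the increasing open sets \<open>H a\<close>; being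
compact, it is contained in one of them. But \<open>x a\<close> is not in \<open>H a\<close>.\<close>

lemma closedin_cover_countable_dense:
  assumes fc: "first_countable X" and cc: "cellular_compact X" and T2: "Hausdorff_space X"
    and F: "closedin X F"
    and U: "\<And>x. x \<in> F \<Longrightarrow> openin X (U x)" "\<And>x. x \<in> F \<Longrightarrow> x \<in> U x"
  shows "\<exists>A\<subseteq>F. countable A \<and> F \<subseteq> X closure_of (\<Union>x\<in>A. U x)"
proof (rule ccontr)
  assume "\<not> ?thesis"
  then have avoid: "\<exists>y. y \<in> F \<and> y \<notin> X closure_of (\<Union>x\<in>A. U x)" if "A \<subseteq> F" "countable A" for A
    using that by blast
  define covers where
    "covers S T \<longleftrightarrow> finite T \<and> T \<subseteq> F \<and> X closure_of S \<subseteq> (\<Union>x\<in>T. U x)" for S T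
  \<comment> \<open>The closure of the segment is compact only in hindsight, so the recursion adds a finite
    cover whenever there is one.\<close>
  define E where "E S = S \<union> (if \<exists>T. covers S T then SOME T. covers S T else {})" for S
  have E: "S \<subseteq> E S \<and> (countable S \<longrightarrow> countable (E S)) \<and> (S \<subseteq> F \<longrightarrow> E S \<subseteq> F)" for S
  proof (cases "\<exists>T. covers S T")
    case True
    then have T: "covers S (SOME T. covers S T)"
      by (rule someI_ex)
    have eq: "E S = S \<union> (SOME T. covers S T)"
      using True by (simp add: E_def)
    show ?thesis
      using T unfolding eq by (simp add: covers_def[of S "Eps _"] countable_finite)
  qed (simp add: E_def)
  have E_covers: "X closure_of S \<subseteq> (\<Union>x\<in>E S. U x)" if S: "S \<subseteq> F" "compactin X (X closure_of S)" for S
  proof -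
    have sub: "X closure_of S \<subseteq> F"
      using S(1) F by (simp add: closure_of_minimal)
    have "\<exists>\<F>. finite \<F> \<and> \<F> \<subseteq> U ` F \<and> X closure_of S \<subseteq> \<Union>\<F>"
      using sub U by (intro compactinD[OF S(2)]) auto
    then obtain \<F> where \<F>: "finite \<F>" "\<F> \<subseteq> U ` F" "X closure_of S \<subseteq> \<Union>\<F>"
      by blast
    obtain T where "T \<subseteq> F" "finite T" "\<F> = U ` T"
      using finite_subset_image[OF \<F>(1,2)] by blast
    then have "covers S T"
      using \<F>(3) by (simp add: covers_def)
    then have "\<exists>T. covers S T" "covers S (SOME T. covers S T)"
      using someI[of "covers S"] by auto
    then show ?thesis
      unfolding E_def covers_def by auto
  qed
  obtain I :: "nat set set" and R where R: "wf R" "trans R" "total_on I R" "R \<subseteq> I \<times> I"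
    and ctbl: "\<And>a. countable {b. (b, a) \<in> R}"
    and bounded: "\<And>J. countable J \<Longrightarrow> J \<subseteq> I \<Longrightarrow> \<exists>a\<in>I. \<forall>j\<in>J. (j, a) \<in> R"
    using omega1_like_order by metis
  define before where "before a = {b. (b, a) \<in> R}" for a
  have before_trans: "before b \<subseteq> before a" if "b \<in> before a" for a b
    using that R(2) by (auto simp: before_def dest: transD)
  \<comment> \<open>All segments up to \<open>a\<close> are included, to make the sets \<open>H a\<close> below increasing.\<close>
  define C where "C x a = (\<Union>b\<in>insert a (before a). E (x ` before b))" for x :: "nat set \<Rightarrow> 'a" and a
  have E_sub_C: "E (x ` before a) \<subseteq> C x a" for x a
    by (auto simp: C_def)
  have C_sub: "C x a \<subseteq> F" if xF: "\<And>b. b \<in> before a \<Longrightarrow> x b \<in> F" for x a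
  proof -
    have "E (x ` before b) \<subseteq> F" if b: "b \<in> insert a (before a)" for b
    proof -
      have "before b \<subseteq> before a"
        using b before_trans[of b a] by auto
      then have "x ` before b \<subseteq> F"
        using xF by (auto simp: subset_iff)
      then show ?thesis
        using E[of "x ` before b"] by simp
    qed
    then show ?thesis
      unfolding C_def by (rule UN_least)
  qed
  have C_ctbl: "countable (C x a)" for x a
    unfolding C_def using ctbl E by (intro countable_UN) (auto simp: before_def)
  have "\<exists>x. \<forall>a. x a \<in> F \<and> x a \<notin> X closure_of (\<Union>z\<in>C x a. U z)"
  proof (rule dependent_wf_choice[OF R(1)])
    fix f g :: "nat set \<Rightarrow> 'a" and a r
    assume eq: "\<And>z. (z, a) \<in> R \<Longrightarrow> f z = g z"
    have "f ` before b = g ` before b" if "b \<in> insert a (before a)" for b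
      using that before_trans[of b a] eq by (intro image_cong) (auto simp: before_def)
    then have "C f a = C g a"
      unfolding C_def by (intro SUP_cong) auto
    then show "(r \<in> F \<and> r \<notin> X closure_of (\<Union>z\<in>C f a. U z)) =
        (r \<in> F \<and> r \<notin> X closure_of (\<Union>z\<in>C g a. U z))"
      by simp
  next
    fix a and f :: "nat set \<Rightarrow> 'a"
    assume "\<And>y. (y, a) \<in> R \<Longrightarrow> f y \<in> F \<and> f y \<notin> X closure_of (\<Union>z\<in>C f y. U z)"
    then have "C f a \<subseteq> F"
      by (intro C_sub) (auto simp: before_def)
    then show "\<exists>r. r \<in> F \<and> r \<notin> X closure_of (\<Union>z\<in>C f a. U z)"
      by (rule avoid[OF _ C_ctbl])
  qed
  then obtain x where "\<forall>a. x a \<in> F \<and> x a \<notin> X closure_of (\<Union>z\<in>C x a. U z)" ..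
  then have x: "x a \<in> F" "x a \<notin> X closure_of (\<Union>z\<in>C x a. U z)" for a
    by simp_all
  define H where "H a = (\<Union>z\<in>C x a. U z)" for a
  have CF: "C x a \<subseteq> F" for a
    using x(1) by (intro C_sub)
  then have H: "openin X (H a)" for a
    unfolding H_def using U(1) by (intro openin_Union) auto
  then have HH: "H a \<subseteq> X closure_of H a" for a
    by (intro closure_of_subset openin_subset)
  have H_mono: "H b \<subseteq> H a" if "(b, a) \<in> R" for a b
  proof -
    have "b \<in> before a"
      using that by (simp add: before_def)
    then have "C x b \<subseteq> C x a"
      unfolding C_def using before_trans[of b a] by (intro UN_mono) auto
    then show ?thesis
      unfolding H_def by (intro UN_mono) auto
  qed
  define W where "W a = U (x a) - X closure_of H a" for a
  have W_open: "openin X (W a)" for a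
    unfolding W_def using U(1) x(1) by (intro openin_diff) auto
  have xW: "x a \<in> W a" for a
    unfolding W_def H_def using U(2)[OF x(1)] x(2) by simp
  have less: "W b \<inter> W a = {}" if "(b, a) \<in> R" for a b
  proof -
    have "x b \<in> x ` before a"
      using that by (simp add: before_def)
    then have "x b \<in> C x a"
      using E[of "x ` before a"] E_sub_C[of x a] by auto
    then have "U (x b) \<subseteq> H a"
      unfolding H_def by (rule UN_upper)
    then show ?thesis
      using HH[of a] by (auto simp: W_def)
  qed
  have disj: "disjoint_family_on W I"
    unfolding disjoint_family_on_def
  proof (intro ballI impI)
    fix a b assume "a \<in> I" "b \<in> I" "a \<noteq> b"
    then consider "(a, b) \<in> R" | "(b, a) \<in> R"
      using R(3) by (auto simp: total_on_def)
    then show "W a \<inter> W b = {}"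
      using less[of a b] less[of b a] by cases auto
  qed
  have cpt: "compactin X (X closure_of (x ` J))" if "J \<subseteq> I" for J
    using that disjoint_family_on_mono[OF that disj]
    by (intro closure_of_disjointly_separated_compact[OF fc cc T2 W_open xW])
  have covered: "\<exists>a\<in>I. y \<in> H a" if y: "y \<in> X closure_of (x ` I)" for y
  proof -
    obtain f where f: "range f \<subseteq> x ` I" "limitin X f y sequentially"
      using first_countable_closure_of_sequence[OF fc y] by blast
    have "\<forall>n. \<exists>j. j \<in> I \<and> f n = x j"
      using f(1) by blast
    then have "\<exists>j. \<forall>n. j n \<in> I \<and> f n = x (j n)"
      by (rule choice)
    then obtain j where "\<forall>n. j n \<in> I \<and> f n = x (j n)" ..
    then have j: "j n \<in> I" "f n = x (j n)" for n
      by simp_all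
    obtain a where a: "a \<in> I" "\<And>n. (j n, a) \<in> R"
      using bounded[of "range j"] j(1) by auto
    define J where "J = range j"
    have "y \<in> X closure_of (x ` J)"
      using f(2) j(2) by (intro limitin_sequentially_imp_closure_of[of X f]) (auto simp: J_def)
    moreover have "J \<subseteq> before a"
      using a(2) by (auto simp: J_def before_def)
    ultimately have "y \<in> X closure_of (x ` before a)"
      using closure_of_mono[of "x ` J" "x ` before a" X] by (auto simp: image_mono)
    moreover have "compactin X (X closure_of (x ` before a))"
      using R(4) by (intro cpt) (auto simp: before_def)
    moreover have "x ` before a \<subseteq> F"
      using x(1) by auto
    ultimately have "y \<in> (\<Union>z\<in>E (x ` before a). U z)"
      using E_covers by blast
    then have "y \<in> H a"
      using E_sub_C[of x a] by (auto simp: H_def)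
    then show ?thesis
      using a(1) by (rule bexI)
  qed
  have "\<exists>\<F>. finite \<F> \<and> \<F> \<subseteq> H ` I \<and> X closure_of (x ` I) \<subseteq> \<Union>\<F>"
    using covered H by (intro compactinD[OF cpt]) auto
  then obtain \<F> where \<F>: "finite \<F>" "\<F> \<subseteq> H ` I" "X closure_of (x ` I) \<subseteq> \<Union>\<F>"
    by blast
  obtain N where N: "N \<subseteq> I" "finite N" "\<F> = H ` N"
    using finite_subset_image[OF \<F>(1,2)] by blast
  obtain a where a: "a \<in> I" "\<And>b. b \<in> N \<Longrightarrow> (b, a) \<in> R"
    using bounded[OF countable_finite[OF N(2)] N(1)] by blast
  have "x ` I \<subseteq> X closure_of (x ` I)"
    using x(1) closedin_subset[OF F] by (intro closure_of_subset) auto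
  then have "x a \<in> \<Union>\<F>"
    using \<F>(3) a(1) by blast
  then obtain b where "b \<in> N" "x a \<in> H b"
    unfolding N(3) by auto
  then have "x a \<in> H a"
    using H_mono[OF a(2)] by auto
  then show False
    using HH[of a] x(2)[of a] by (auto simp: H_def)
qed

section \<open>Closing off under countably many arguments\<close>

text \<open>Terms built from one constant by operations of arity \<open>\<omega>\<close>. They replace a transfinite iteration of
length \<open>\<omega>\<^sub>1\<close>: the set of values of all terms is closed under the operations at once, since any
sequence of terms is the argument list of a further term.\<close>

datatype 'i wtree = Leaf | Node 'i "nat \<Rightarrow> 'i wtree"

primrec wtree_eval :: "'a \<Rightarrow> ('i \<Rightarrow> (nat \<Rightarrow> 'a) \<Rightarrow> 'a) \<Rightarrow> 'i wtree \<Rightarrow> 'a" where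
  "wtree_eval a \<Phi> Leaf = a"
| "wtree_eval a \<Phi> (Node i t) = \<Phi> i (\<lambda>n. wtree_eval a \<Phi> (t n))"

text \<open>The labelled positions of a term. The root contributes \<open>([], 0)\<close>, which tells a node from a leaf
even if its label has the empty code, and a pair \<open>([], Suc j)\<close> for each element \<open>j\<close> of the code of
its label; the positions in the \<open>n\<close>-th subterm are prefixed by \<open>n\<close>.\<close>

primrec wtree_code :: "('i \<Rightarrow> nat set) \<Rightarrow> 'i wtree \<Rightarrow> (nat list \<times> nat) set" where
  "wtree_code e Leaf = {}"
| "wtree_code e (Node i t) =
     insert ([], 0) ({([], Suc j) |j. j \<in> e i} \<union> (\<Union>n. {(n # p, k) |p k. (p, k) \<in> wtree_code e (t n)}))"

lemma inj_wtree_code: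
  assumes "inj e"
  shows "inj (wtree_code e)"
proof -
  have "wtree_code e t = wtree_code e u \<Longrightarrow> t = u" for t u
  proof (induction t arbitrary: u)
    case Leaf
    then show ?case
      by (cases u) auto
  next
    case (Node i t)
    then obtain j v where u: "u = Node j v"
      by (cases u) auto
    have eq: "wtree_code e (Node i t) = wtree_code e (Node j v)"
      using Node.prems u by simp
    have "e i = {k. ([], Suc k) \<in> wtree_code e (Node i t)}"
      by auto
    moreover have "e j = {k. ([], Suc k) \<in> wtree_code e (Node j v)}"
      by auto
    ultimately have "e i = e j"
      by (simp only: eq)
    then have "i = j"
      using assms by (simp add: inj_eq)
    moreover have "t n = v n" for n
    proof -
      have "wtree_code e (t n) = {(p, k). (n # p, k) \<in> wtree_code e (Node i t)}"
        by auto
      moreover have "wtree_code e (v n) = {(p, k). (n # p, k) \<in> wtree_code e (Node j v)}"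
        by auto
      ultimately have "wtree_code e (t n) = wtree_code e (v n)"
        by (simp only: eq)
      then show ?thesis
        by (intro Node.IH) auto
    qed
    ultimately show ?case
      using u by auto
  qed
  then show ?thesis
    by (auto simp: inj_def)
qed

text \<open>There are at most continuum many terms because their codes are subsets of a countable set.\<close>

lemma closure_under_countable_operations:
  fixes \<Phi> :: "'i \<Rightarrow> (nat \<Rightarrow> 'a) \<Rightarrow> 'a" and e :: "'i \<Rightarrow> nat set"
  assumes "inj e" "a \<in> Z" "\<And>i f. range f \<subseteq> Z \<Longrightarrow> \<Phi> i f \<in> Z"
  shows "\<exists>F. a \<in> F \<and> F \<subseteq> Z \<and> F \<lesssim> Pow (UNIV :: nat set) \<and>
      (\<forall>i f. range f \<subseteq> F \<longrightarrow> \<Phi> i f \<in> F)"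
proof -
  define F where "F = range (wtree_eval a \<Phi>)"
  have "a \<in> F"
    unfolding F_def by (rule range_eqI[of _ _ Leaf]) simp
  moreover have "F \<subseteq> Z"
  proof -
    have "wtree_eval a \<Phi> t \<in> Z" for t
      by (induction t) (auto intro!: assms(2,3))
    then show ?thesis
      by (auto simp: F_def)
  qed
  moreover have "F \<lesssim> Pow (UNIV :: nat set)"
  proof -
    have "inj (\<lambda>t. to_nat ` wtree_code e t)"
      using inj_wtree_code[OF assms(1)] by (simp add: inj_def inj_image_eq_iff)
    then have "(UNIV :: 'i wtree set) \<lesssim> Pow (UNIV :: nat set)"
      unfolding lepoll_def by auto
    then show ?thesis
      unfolding F_def using image_lepoll lepoll_trans by blast
  qed
  moreover have "\<Phi> i f \<in> F" if f: "range f \<subseteq> F" for i f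
  proof -
    have "\<forall>n. \<exists>t. f n = wtree_eval a \<Phi> t"
      using f by (auto simp: F_def)
    then have "\<exists>t. \<forall>n. f n = wtree_eval a \<Phi> (t n)"
      by (rule choice)
    then obtain t where "\<forall>n. f n = wtree_eval a \<Phi> (t n)" ..
    then have "\<Phi> i f = wtree_eval a \<Phi> (Node i t)"
      by (simp flip: fun_eq_iff)
    then show ?thesis
      by (simp only: F_def rangeI)
  qed
  ultimately show ?thesis
    by (intro exI[of _ F]) simp
qed

section \<open>The cardinality bound\<close>

text \<open>Let \<open>F\<close> be closed under limits of sequences and under an operation that picks a point outside the
closure of a union of countably many basic neighbourhoods of points of \<open>F\<close> whenever this union is
not dense. Then \<open>F\<close> is closed in \<open>X\<close>. If \<open>p\<close> were not in \<open>F\<close>, regularity would give basic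
neighbourhoods of the points of \<open>F\<close> within an open set whose closure misses \<open>p\<close>; countably many
of them have \<open>F\<close> in the closure of their union, although the operation yields a point of \<open>F\<close>
outside this closure.\<close>

lemma regular_first_countable_lepoll_continuum:
  assumes fc: "first_countable X" and T2: "Hausdorff_space X" and reg: "regular_space X"
    and wL: "\<And>F U. closedin X F \<Longrightarrow> (\<And>x. x \<in> F \<Longrightarrow> openin X (U x) \<and> x \<in> U x) \<Longrightarrow>
        \<exists>A\<subseteq>F. countable A \<and> F \<subseteq> X closure_of (\<Union>x\<in>A. U x)"
  shows "topspace X \<lesssim> Pow (UNIV :: nat set)"
proof (cases "topspace X = {}")
  case True
  then show ?thesis
    by simp
next
  case False
  then obtain a where a: "a \<in> topspace X"
    by blast
  have "\<forall>x. \<exists>B. x \<in> topspace X \<longrightarrow> decreasing_base X x B"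
    using first_countable_decreasing_base[OF fc] by metis
  then obtain B where B: "\<And>x. x \<in> topspace X \<Longrightarrow> decreasing_base X x (B x)"
    by metis
  define G where "G m f = X closure_of (\<Union>n. B (f n) (m n))" for m :: "nat \<Rightarrow> nat" and f
  define lm where "lm f = (if \<exists>l. limitin X f l sequentially then SOME l. limitin X f l sequentially else a)" for f
  define av where "av m f = (if topspace X \<subseteq> G m f then a else SOME y. y \<in> topspace X - G m f)" for m f
  define \<Phi> where "\<Phi> i f = (case i of None \<Rightarrow> lm f | Some m \<Rightarrow> av m f)" for i f
  have lm: "lm f = l" if "limitin X f l sequentially" for f l
  proof -
    have "limitin X f (lm f) sequentially"
      using that someI[of "\<lambda>l. limitin X f l sequentially"] by (auto simp: lm_def)
    then show ?thesis
      using limitin_Hausdorff_unique[OF _ that _ T2] by simp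
  qed
  have av: "av m f \<in> topspace X - G m f" if "\<not> topspace X \<subseteq> G m f" for m f
    using that someI_ex[of "\<lambda>y. y \<in> topspace X - G m f"] by (auto simp: av_def)
  have lm_in: "lm f \<in> topspace X" for f
    using lm[of f] a limitin_topspace[of X f] by (metis lm_def)
  have av_in: "av m f \<in> topspace X" for m f
    using av[of m f] a by (cases "topspace X \<subseteq> G m f") (auto simp: av_def)
  define e where "e i = (case i of None \<Rightarrow> {} | Some m \<Rightarrow> range (\<lambda>j. to_nat (j, m j)))"
    for i :: "(nat \<Rightarrow> nat) option"
  have "m = m'" if "range (\<lambda>j. to_nat (j, m j)) = range (\<lambda>j. to_nat (j, m' j))" for m m' :: "nat \<Rightarrow> nat"
  proof
    fix j
    have "to_nat (j, m j) \<in> range (\<lambda>j. to_nat (j, m' j))"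
      unfolding that[symmetric] by (rule rangeI)
    then show "m j = m' j"
      by auto
  qed
  then have inj: "inj e"
    unfolding inj_def e_def by (auto split: option.splits)
  have \<Phi>_in: "\<Phi> i f \<in> topspace X" for i f
    using lm_in av_in by (cases i) (simp_all add: \<Phi>_def)
  have "\<exists>F. a \<in> F \<and> F \<subseteq> topspace X \<and> F \<lesssim> Pow (UNIV :: nat set) \<and>
      (\<forall>i f. range f \<subseteq> F \<longrightarrow> \<Phi> i f \<in> F)"
    by (rule closure_under_countable_operations[OF inj a]) (rule \<Phi>_in)
  then obtain F where F: "a \<in> F" "F \<subseteq> topspace X" "F \<lesssim> Pow (UNIV :: nat set)"
    and "\<forall>i f. range f \<subseteq> F \<longrightarrow> \<Phi> i f \<in> F"
    by (elim exE conjE)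
  then have clos: "\<Phi> i f \<in> F" if "range f \<subseteq> F" for i f
    using that by simp
  have F_lm: "lm f \<in> F" and F_av: "av m f \<in> F" if "range f \<subseteq> F" for f m
    using clos[OF that, of None] clos[OF that, of "Some m"] by (simp_all add: \<Phi>_def)
  have "X closure_of F \<subseteq> F"
  proof
    fix y assume "y \<in> X closure_of F"
    then obtain f where "range f \<subseteq> F" "limitin X f y sequentially"
      using first_countable_closure_of_sequence[OF fc] by blast
    then show "y \<in> F"
      using F_lm lm by metis
  qed
  then have closed: "closedin X F"
    using F(2) by (simp flip: closure_of_subset_eq)
  have "p \<in> F" if p: "p \<in> topspace X" for p
  proof (rule ccontr)
    assume "p \<notin> F"
    then obtain V V' where V: "openin X V" "openin X V'" "p \<in> V" "F \<subseteq> V'" "disjnt V V'"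
      using reg closed p unfolding regular_space_def by (metis DiffI)
    have "\<forall>x. \<exists>k. x \<in> F \<longrightarrow> B x k \<subseteq> V'"
      using decreasing_baseD(4)[OF B V(2)] F(2) V(4) by blast
    then obtain k where k: "\<And>x. x \<in> F \<Longrightarrow> B x (k x) \<subseteq> V'"
      by metis
    have "openin X (B x (k x)) \<and> x \<in> B x (k x)" if "x \<in> F" for x
      using decreasing_baseD(1,2)[OF B] F(2) that by blast
    then obtain A where A: "A \<subseteq> F" "countable A" "F \<subseteq> X closure_of (\<Union>x\<in>A. B x (k x))"
      using wL[OF closed, of "\<lambda>x. B x (k x)"] by metis
    \<comment> \<open>The point \<open>a\<close> is inserted because \<open>A\<close> may be empty.\<close>
    define f where "f = from_nat_into (insert a A)"
    define m where "m n = k (f n)" for n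
    have ran: "range f = insert a A"
      unfolding f_def using A(2) by (intro range_from_nat_into) auto
    have fF: "range f \<subseteq> F"
      using ran A(1) F(1) by simp
    have un: "(\<Union>n. B (f n) (m n)) = (\<Union>x\<in>insert a A. B x (k x))"
      unfolding m_def ran[symmetric] by simp
    have "X closure_of (\<Union>x\<in>A. B x (k x)) \<subseteq> G m f"
      unfolding G_def un by (intro closure_of_mono) auto
    then have FG: "F \<subseteq> G m f"
      using A(3) by blast
    have "(\<Union>n. B (f n) (m n)) \<subseteq> V'"
      unfolding un using k A(1) F(1) by blast
    then have "p \<notin> G m f"
      using V(1,3,5) unfolding G_def in_closure_of disjnt_def by blast
    then have "av m f \<notin> G m f"
      using av[of m f] p by blast
    then show False
      using F_av[OF fF] FG by blast
  qed
  then have "topspace X = F"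
    using F(2) by blast
  then show ?thesis
    using F(3) by simp
qed

theorem mainTheorem1:
  fixes X :: "'a topology"
  assumes "first_countable X"
    and "cellular_compact X"
    and "Hausdorff_space X"
  shows "T3_space X \<and> topspace X \<lesssim> Pow (UNIV :: nat set)"
proof -
  have reg: "regular_space X"
    using assms by (rule cellular_compact_imp_regular_space)
  moreover have "t1_space X"
    using assms(3) by (rule Hausdorff_imp_t1_space)
  moreover have "topspace X \<lesssim> Pow (UNIV :: nat set)"
    using closedin_cover_countable_dense[OF assms]
    by (intro regular_first_countable_lepoll_continuum[OF assms(1,3) reg]) blast
  ultimately show ?thesis
    by (simp add: T3_space_def)
qed

end
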